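(* For every non-trivial connected graph $G$ and every graph $H$ with $\gamma_{r2}(H)=2$, \[\gamma_{r2}(G\circ H)=2\gamma(G).\]
   Context: All graphs are finite and simple; non-trivial means at least two vertices. A $2$-rainbow dominating function of a graph $X$ is a map $f\colon V(X)\to 2^{\{1,2\}}$ such that for every vertex $v$ with $f(v)=\emptyset$ we have $\bigcup_{u\in N(v)} f(u)=\{1,2\}$; its weight is $\sum_v |f(v)|$, and $\gamma_{r2}(X)$ is the minimum weight of such a function. The lexicographic product $G\circ H$ has vertex set $V(G)\times V(H)$, with $(g_1,h_1)$ adjacent to $(g_2,h_2)$ iff $g_1g_2\in E(G)$, or $g_1=g_2$ and $h_1h_2\in E(H)$. $\gamma(G)$ is the domination number of $G$. *)

theory Defs
  imports "Graph_Theory.Pair_Digraph" "Graph_Theory.Digraph_Component"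
begin

text \<open>
  Finite simple graphs are the library's \<^locale>\<open>pair_graph\<close>s: finite, loopless digraphs whose arc set
  is a symmetric set of pairs, so that an edge \<open>uv\<close> is the pair of arcs \<open>(u, v)\<close> and \<open>(v, u)\<close>.
\<close>

definition nbhd :: "'a pair_pre_digraph \<Rightarrow> 'a \<Rightarrow> 'a set" where
  "nbhd X v = {u. (v, u) \<in> parcs X}"

definition lex_product ::
  "'a pair_pre_digraph \<Rightarrow> 'b pair_pre_digraph \<Rightarrow> ('a \<times> 'b) pair_pre_digraph" where
  "lex_product G H = \<lparr> pverts = pverts G \<times> pverts H,
     parcs = {((g1, h1), (g2, h2)) | g1 h1 g2 h2.
       (g1, h1) \<in> pverts G \<times> pverts H \<and> (g2, h2) \<in> pverts G \<times> pverts H \<and>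
       ((g1, g2) \<in> parcs G \<or> g1 = g2 \<and> (h1, h2) \<in> parcs H)} \<rparr>"

definition dominating_set :: "'a pair_pre_digraph \<Rightarrow> 'a set \<Rightarrow> bool" where
  "dominating_set X D \<longleftrightarrow> D \<subseteq> pverts X \<and> (\<forall>v \<in> pverts X - D. nbhd X v \<inter> D \<noteq> {})"

definition domination_number :: "'a pair_pre_digraph \<Rightarrow> nat" where
  "domination_number X = (LEAST n. \<exists>D. dominating_set X D \<and> card D = n)"

text \<open>
  A function on \<open>V(X)\<close> is represented by a total function whose values outside \<open>V(X)\<close> are
  irrelevant: on a \<^locale>\<open>pair_graph\<close> neither the condition nor the weight depends on them.
\<close>

definition rainbow2_dominating :: "'a pair_pre_digraph \<Rightarrow> ('a \<Rightarrow> nat set) \<Rightarrow> bool" where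
  "rainbow2_dominating X f \<longleftrightarrow>
     (\<forall>v \<in> pverts X. f v \<subseteq> {1, 2}) \<and>
     (\<forall>v \<in> pverts X. f v = {} \<longrightarrow> (\<Union>u \<in> nbhd X v. f u) = {1, 2})"

definition weight :: "'a pair_pre_digraph \<Rightarrow> ('a \<Rightarrow> nat set) \<Rightarrow> nat" where
  "weight X f = (\<Sum>v \<in> pverts X. card (f v))"

definition rainbow2_domination_number :: "'a pair_pre_digraph \<Rightarrow> nat" where
  "rainbow2_domination_number X = (LEAST n. \<exists>f. rainbow2_dominating X f \<and> weight X f = n)"

text \<open>Both minima range over nonempty sets and are therefore attained.\<close>

lemma domination_number_attained:
  "\<exists>D. dominating_set X D \<and> card D = domination_number X"
  unfolding domination_number_def
  by (rule LeastI_ex) (auto simp: dominating_set_def)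

lemma rainbow2_domination_number_attained:
  "\<exists>f. rainbow2_dominating X f \<and> weight X f = rainbow2_domination_number X"
proof -
  have "rainbow2_dominating X (\<lambda>_. {1})"
    by (simp add: rainbow2_dominating_def)
  then have "\<exists>n f. rainbow2_dominating X f \<and> weight X f = n"
    by blast
  then show ?thesis
    unfolding rainbow2_domination_number_def by (rule LeastI_ex)
qed

lemma pair_graph_lex_product:
  assumes "pair_graph G" and "pair_graph H"
  shows "pair_graph (lex_product G H)"
proof -
  interpret G: pair_graph G by fact
  interpret H: pair_graph H by fact
  have fin: "finite (pverts (lex_product G H))"
    by (simp add: lex_product_def G.pair_finite_verts H.pair_finite_verts)
  have sub: "parcs (lex_product G H) \<subseteq> pverts (lex_product G H) \<times> pverts (lex_product G H)"
    by (auto simp: lex_product_def)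
  show ?thesis
  proof unfold_locales
    show "finite (pverts (lex_product G H))" by (rule fin)
    show "finite (parcs (lex_product G H))"
      using finite_subset[OF sub] fin by simp
    show "symmetric (with_proj (lex_product G H))"
      by (auto simp: symmetric_def sym_def lex_product_def
          intro: G.arcs_symmetric H.arcs_symmetric)
  next
    fix e assume "e \<in> parcs (lex_product G H)"
    then show "fst e \<noteq> snd e"
      by (auto simp: lex_product_def dest: G.no_loops' H.no_loops')
  qed (use sub in auto)
qed

end

theory Submission
  imports Defs
begin

text \<open>
  Copying a rainbow dominating function of \<open>H\<close> of weight 2 that uses both colours into the layers over
  a minimum dominating set of \<open>G\<close> gives the upper bound. Conversely, given a rainbow dominating
  function of \<open>G \<circ> H\<close>, the vertices of \<open>G\<close> whose layer has weight at least 2 or uses the colour \<open>i\<close>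
  form a dominating set for each \<open>i\<close>: any other layer has weight at most 1, hence contains a vertex
  coloured \<open>{}\<close>, and the colour \<open>i\<close> must reach that vertex from an adjacent layer. A vertex of \<open>G\<close>
  lies in at most as many of these two sets as the weight of its layer.
\<close>

lemma domination_number_le:
  "dominating_set X D \<Longrightarrow> domination_number X \<le> card D"
  unfolding domination_number_def by (rule Least_le) blast

lemma rainbow2_domination_number_le:
  "rainbow2_dominating X f \<Longrightarrow> rainbow2_domination_number X \<le> weight X f"
  unfolding rainbow2_domination_number_def by (rule Least_le) blast

lemma rainbow2_domination_number_le_card:
  "rainbow2_domination_number X \<le> card (pverts X)"
  using rainbow2_domination_number_le[of X "\<lambda>_. {1}"]
  by (simp add: rainbow2_dominating_def weight_def)

lemma nbhd_lex_product:
  assumes "g \<in> pverts G" "h \<in> pverts H"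
  shows "nbhd (lex_product G H) (g, h) =
    {(g', h'). g' \<in> pverts G \<and> h' \<in> pverts H \<and> (g' \<in> nbhd G g \<or> g' = g \<and> h' \<in> nbhd H h)}"
  using assms by (auto simp: nbhd_def lex_product_def)

lemma weight_lex_product:
  "weight (lex_product G H) f = (\<Sum>g \<in> pverts G. \<Sum>h \<in> pverts H. card (f (g, h)))"
  by (simp add: weight_def lex_product_def sum.cartesian_product)

text \<open>A minimum function can be monochromatic when \<open>H\<close> has just two vertices, so
  an arbitrary one cannot be copied into layers. An empty vertex already sees both colours; without
  one, \<open>H\<close> has two vertices and can be recoloured.\<close>

lemma rainbow2_dominating_both_colours:
  assumes "pair_graph H" and "rainbow2_domination_number H = 2"
  obtains f where "rainbow2_dominating H f" "weight H f = 2" "(\<Union>v \<in> pverts H. f v) = {1, 2}"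
proof -
  interpret H: pair_graph H by fact
  obtain f where f: "rainbow2_dominating H f" "weight H f = 2"
    using rainbow2_domination_number_attained[of H] assms(2) by auto
  show thesis
  proof (cases "\<exists>v \<in> pverts H. f v = {}")
    case True
    then obtain v where v: "v \<in> pverts H" "f v = {}" by blast
    then have "(\<Union>u \<in> nbhd H v. f u) = {1, 2}"
      using f(1) by (auto simp: rainbow2_dominating_def)
    moreover have "nbhd H v \<subseteq> pverts H"
      using H.in_arcsD2 by (auto simp: nbhd_def)
    ultimately have "{1, 2} \<subseteq> (\<Union>v \<in> pverts H. f v)" by blast
    moreover have "(\<Union>v \<in> pverts H. f v) \<subseteq> {1, 2}"
      using f(1) by (auto simp: rainbow2_dominating_def)
    ultimately have "(\<Union>v \<in> pverts H. f v) = {1, 2}" by (rule subset_antisym[rotated])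
    then show thesis by (rule that[OF f])
  next
    case False
    have "1 \<le> card (f v)" if "v \<in> pverts H" for v
    proof -
      have "finite (f v)"
        using that f(1) by (auto simp: rainbow2_dominating_def intro: finite_subset)
      then show ?thesis using False that by (simp add: Suc_le_eq card_gt_0_iff)
    qed
    then have "(\<Sum>v \<in> pverts H. 1) \<le> weight H f"
      unfolding weight_def by (rule sum_mono)
    \<comment> \<open>Nonempty values give at most 2 vertices; the constant function
      \<open>{1}\<close> gives at least 2.\<close>
    then have "card (pverts H) = 2"
      using f(2) rainbow2_domination_number_le_card[of H] assms(2) by simp
    then obtain a b where ab: "pverts H = {a, b}" "a \<noteq> b"
      by (auto simp: card_2_iff)
    show thesis
      by (rule that[of "\<lambda>v. if v = a then {1} else {2}"])
        (use ab in \<open>auto simp: rainbow2_dominating_def weight_def\<close>)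
  qed
qed

lemma rainbow2_domination_number_lex_product_le:
  assumes "pair_graph G" and "pair_graph H" and "rainbow2_domination_number H = 2"
  shows "rainbow2_domination_number (lex_product G H) \<le> 2 * domination_number G"
proof -
  interpret G: pair_graph G by fact
  interpret H: pair_graph H by fact
  obtain D where D: "dominating_set G D" "card D = domination_number G"
    using domination_number_attained by blast
  obtain \<phi> where \<phi>: "rainbow2_dominating H \<phi>" "weight H \<phi> = 2" "(\<Union>v \<in> pverts H. \<phi> v) = {1, 2}"
    using rainbow2_dominating_both_colours[OF assms(2,3)] .
  have DG: "D \<subseteq> pverts G" using D(1) by (simp add: dominating_set_def)
  define f where "f = (\<lambda>(g, h). if g \<in> D then \<phi> h else {})"
  have range: "\<phi> h \<subseteq> {1, 2}" if "h \<in> pverts H" for h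
    using \<phi>(1) that by (simp add: rainbow2_dominating_def)
  have "(\<Union>u \<in> nbhd (lex_product G H) (g, h). f u) = {1, 2}"
    if gh: "g \<in> pverts G" "h \<in> pverts H" and empty: "f (g, h) = {}" for g h
  proof
    show "(\<Union>u \<in> nbhd (lex_product G H) (g, h). f u) \<subseteq> {1, 2}"
      using range by (fastforce simp: nbhd_lex_product[OF gh] f_def split: if_splits)
    show "{1, 2} \<subseteq> (\<Union>u \<in> nbhd (lex_product G H) (g, h). f u)"
    proof (cases "g \<in> D")
      case True
      \<comment> \<open>In a copied layer, an empty vertex sees both colours within that
        layer.\<close>
      then have "(\<Union>u \<in> nbhd H h. \<phi> u) = {1, 2}"
        using \<phi>(1) gh(2) empty by (simp add: rainbow2_dominating_def f_def)
      moreover have "nbhd H h \<subseteq> pverts H"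
        using H.in_arcsD2 by (auto simp: nbhd_def)
      then have "(\<Union>u \<in> nbhd H h. \<phi> u) \<subseteq> (\<Union>u \<in> nbhd (lex_product G H) (g, h). f u)"
        using True gh(1) by (fastforce simp: nbhd_lex_product[OF gh] f_def)
      ultimately show ?thesis by simp
    next
      case False
      then obtain g' where g': "g' \<in> nbhd G g" "g' \<in> D"
        using D(1) gh(1) by (auto simp: dominating_set_def)
      \<comment> \<open>All of the layer over \<open>g'\<close> is adjacent to
        \<open>(g, h)\<close>, so every colour used by \<open>\<phi>\<close> is seen. This is where
        \<open>\<phi>\<close> must use both colours.\<close>
      then have "(\<Union>v \<in> pverts H. \<phi> v) \<subseteq> (\<Union>u \<in> nbhd (lex_product G H) (g, h). f u)"
        using DG by (fastforce simp: nbhd_lex_product[OF gh] f_def)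
      then show ?thesis by (simp only: \<phi>(3))
    qed
  qed
  then have "rainbow2_dominating (lex_product G H) f"
    using range by (auto simp: rainbow2_dominating_def f_def lex_product_def)
  moreover have "weight (lex_product G H) f = 2 * card D"
  proof -
    have "weight (lex_product G H) f = (\<Sum>g \<in> pverts G. if g \<in> D then 2 else 0)"
      unfolding weight_lex_product
    proof (rule sum.cong)
      show "(\<Sum>h \<in> pverts H. card (f (g, h))) = (if g \<in> D then 2 else 0)" for g
        using \<phi>(2) by (simp add: weight_def f_def)
    qed simp
    also have "\<dots> = 2 * card D"
      using DG by (simp add: sum.If_cases Int_absorb1)
    finally show ?thesis .
  qed
  ultimately show ?thesis
    using rainbow2_domination_number_le[of "lex_product G H" f] D(2) by simp
qed

lemma le_rainbow2_domination_number_lex_product: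
  assumes "pair_graph G" and "pair_graph H" and "card (pverts H) \<ge> 2"
  shows "2 * domination_number G \<le> rainbow2_domination_number (lex_product G H)"
proof -
  interpret G: pair_graph G by fact
  interpret H: pair_graph H by fact
  obtain f where f: "rainbow2_dominating (lex_product G H) f"
    "weight (lex_product G H) f = rainbow2_domination_number (lex_product G H)"
    using rainbow2_domination_number_attained by blast
  define w where "w g = (\<Sum>h \<in> pverts H. card (f (g, h)))" for g
  define F where "F g = (\<Union>h \<in> pverts H. f (g, h))" for g
  \<comment> \<open>A layer of weight at least 2 can pay for membership in both sets, even if it
    shows a single colour.\<close>
  define A where "A i = {g \<in> pverts G. i \<in> F g \<or> 2 \<le> w g}" for i
  have range: "f (g, h) \<subseteq> {1, 2}" if "g \<in> pverts G" "h \<in> pverts H" for g h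
    using f(1) that by (simp add: rainbow2_dominating_def lex_product_def)
  have "dominating_set G (A i)" if i: "i \<in> {1, 2}" for i
    unfolding dominating_set_def
  proof (intro conjI ballI)
    show "A i \<subseteq> pverts G" by (auto simp: A_def)
    fix g assume g: "g \<in> pverts G - A i"
    \<comment> \<open>Otherwise the layer has weight at least
      \<open>card (pverts H) \<ge> 2\<close>, which puts \<open>g\<close> in
      \<open>A i\<close>.\<close>
    have "\<exists>h \<in> pverts H. f (g, h) = {}"
    proof (rule ccontr)
      assume nonempty: "\<not> ?thesis"
      have "1 \<le> card (f (g, h))" if "h \<in> pverts H" for h
      proof -
        have "finite (f (g, h))" using range g that by (meson DiffD1 finite.simps finite_subset)
        then show ?thesis using nonempty that by (simp add: Suc_le_eq card_gt_0_iff)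
      qed
      then have "(\<Sum>h \<in> pverts H. 1) \<le> w g"
        unfolding w_def by (rule sum_mono)
      then show False using assms(3) g by (simp add: A_def)
    qed
    then obtain h where h: "h \<in> pverts H" "f (g, h) = {}" by blast
    then have "i \<in> (\<Union>u \<in> nbhd (lex_product G H) (g, h). f u)"
      using f(1) g i by (simp add: rainbow2_dominating_def lex_product_def)
    then obtain g' h' where g': "g' \<in> pverts G" "h' \<in> pverts H" "i \<in> f (g', h')"
      "g' \<in> nbhd G g \<or> g' = g"
      using nbhd_lex_product[of g G h H] g h(1) by auto
    \<comment> \<open>Since \<open>g\<close> is outside \<open>A i\<close>, this rules out
      \<open>g' = g\<close>: the colour \<open>i\<close> comes from another layer.\<close>
    then have "g' \<in> A i" by (auto simp: A_def F_def)
    then show "nbhd G g \<inter> A i \<noteq> {}" using g g'(4) by blast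
  qed
  then have "2 * domination_number G \<le> card (A 1) + card (A 2)"
    using domination_number_le[of G "A 1"] domination_number_le[of G "A 2"] by simp
  \<comment> \<open>The two cardinalities are now counted vertex by vertex, to be compared with the
    weight of each layer.\<close>
  also have "\<dots> = (\<Sum>g \<in> pverts G. of_bool (g \<in> A 1) + of_bool (g \<in> A 2))"
  proof -
    have "pverts G \<inter> A i = A i" for i by (auto simp: A_def)
    then show ?thesis by (simp only: sum.distrib sum_of_bool_eq G.pair_finite_verts Collect_mem_eq of_nat_id)
  qed
  also have "\<dots> \<le> (\<Sum>g \<in> pverts G. w g)"
  proof (rule sum_mono)
    fix g assume g: "g \<in> pverts G"
    have "F g \<subseteq> {1, 2}" using range g by (auto simp: F_def)
    then have "F g \<in> {{}, {1}, {2}, {1, 2}}" by auto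
    then have "of_bool (1 \<in> F g) + of_bool (2 \<in> F g) = card (F g)"
      by (elim insertE emptyE) simp_all
    also have "\<dots> \<le> w g"
      unfolding F_def w_def by (rule card_UN_le) simp
    \<comment> \<open>A layer of weight at least 2 is counted at most twice; a lighter one is
      counted once per colour in \<open>F g\<close>, and each colour costs at least 1.\<close>
    finally show "of_bool (g \<in> A 1) + of_bool (g \<in> A 2) \<le> w g"
      using g by (cases "2 \<le> w g") (simp_all add: A_def)
  qed
  also have "\<dots> = rainbow2_domination_number (lex_product G H)"
    using f(2) by (simp add: weight_lex_product w_def)
  finally show ?thesis .
qed

theorem theorem10:
  fixes G :: "'a pair_pre_digraph" and H :: "'b pair_pre_digraph"
  assumes "pair_graph G" and "Digraph_Component.connected (with_proj G)" and "card (pverts G) \<ge> 2"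
    and "pair_graph H" and "rainbow2_domination_number H = 2"
  shows "rainbow2_domination_number (lex_product G H) = 2 * domination_number G"
proof (rule antisym)
  show "rainbow2_domination_number (lex_product G H) \<le> 2 * domination_number G"
    using assms(1,4,5) by (rule rainbow2_domination_number_lex_product_le)
  have "card (pverts H) \<ge> 2"
    using rainbow2_domination_number_le_card[of H] assms(5) by simp
  with assms(1,4) show "2 * domination_number G \<le> rainbow2_domination_number (lex_product G H)"
    by (rule le_rainbow2_domination_number_lex_product)
qed

end
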